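(* Let $P = \{p_1, \ldots, p_d\}$ be a finite partially ordered set and let $\mathcal{C}(P) \subset \mathbb{R}^d$ be its chain polytope, with vertex set $V(\mathcal{C}(P))$ and $1$-skeleton $\mathrm{sk}(\mathcal{C}(P))$. Suppose that a subset $C \subset V(\mathcal{C}(P))$ is a $k$-clique of $\mathrm{sk}(\mathcal{C}(P))$. Then $\mathrm{conv}(C)$ is a face of $\mathcal{C}(P)$ and is a $(k-1)$-dimensional simplex.
   Context: An antichain of $P$ is a subset $W \subset P$ such that any two distinct elements of $W$ are incomparable in $P$; the empty set and each singleton $\{p_i\}$ are antichains. Let $\mathbf{e}_1, \ldots, \mathbf{e}_d$ be the canonical unit coordinate vectors of $\mathbb{R}^d$, and for $W \subset P$ put $\rho(W) = \sum_{p_i \in W} \mathbf{e}_i \in \mathbb{R}^d$ (so $\rho(\emptyset)$ is the origin). The chain polytope of $P$ is the convex hull $\mathcal{C}(P) = \mathrm{conv}(\{\rho(W) : W \text{ is an antichain of } P\})$ in $\mathbb{R}^d$. For a convex polytope $\mathcal{P}$ with vertex set $V(\mathcal{P})$, the $1$-skeleton $\mathrm{sk}(\mathcal{P})$ is the finite simple graph on $V(\mathcal{P})$ whose edges are the pairs $\{v, w\}$ with $v, w \in V(\mathcal{P})$ such that $\mathrm{conv}(\{v, w\})$ is an edge ($1$-dimensional face) of $\mathcal{P}$. A clique of $\mathrm{sk}(\mathcal{P})$ is a complete subgraph, identified with its set of vertices; a $k$-clique is a clique consisting of $k$ vertices. *)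

theory Defs
  imports "HOL-Analysis.Analysis"
begin

text \<open>A finite poset is a carrier \<open>P\<close> with an order relation \<open>r\<close>, where
  \<open>(x, y) \<in> r\<close> means \<open>x \<le> y\<close>. An enumeration \<open>p\<^sub>1, \<dots>, p\<^sub>d\<close> of \<open>P\<close> is a
  bijection \<open>p\<close> from a finite index type \<open>'n\<close> with \<open>d\<close> elements onto \<open>P\<close>.\<close>

definition antichain_of :: "'a set \<Rightarrow> 'a rel \<Rightarrow> 'a set \<Rightarrow> bool" where
  "antichain_of P r W \<longleftrightarrow>
     W \<subseteq> P \<and> (\<forall>x\<in>W. \<forall>y\<in>W. x \<noteq> y \<longrightarrow> (x, y) \<notin> r \<and> (y, x) \<notin> r)"

definition rho :: "('n::finite \<Rightarrow> 'a) \<Rightarrow> 'a set \<Rightarrow> real ^ 'n" where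
  "rho p W = (\<Sum>i | p i \<in> W. axis i 1)"

definition chain_polytope :: "'a set \<Rightarrow> 'a rel \<Rightarrow> ('n::finite \<Rightarrow> 'a) \<Rightarrow> (real ^ 'n) set" where
  "chain_polytope P r p = convex hull {rho p W | W. antichain_of P r W}"

definition vertices :: "'v::euclidean_space set \<Rightarrow> 'v set" where
  "vertices S = {v. v extreme_point_of S}"

text \<open>Simple graphs are pairs of a vertex set and a set of two-element edges. In \<open>skeleton\<close>
  the endpoints are automatically distinct, since \<^const>\<open>edge_of\<close> requires affine dimension 1.\<close>

definition skeleton :: "'v::euclidean_space set \<Rightarrow> 'v set \<times> 'v set set" where
  "skeleton S = (vertices S,
     {{v, w} | v w. v \<in> vertices S \<and> w \<in> vertices S \<and> (convex hull {v, w}) edge_of S})"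

definition clique_of :: "'v set \<times> 'v set set \<Rightarrow> nat \<Rightarrow> 'v set \<Rightarrow> bool" where
  "clique_of G k C \<longleftrightarrow>
     C \<subseteq> fst G \<and> (\<forall>v\<in>C. \<forall>w\<in>C. v \<noteq> w \<longrightarrow> {v, w} \<in> snd G) \<and> finite C \<and> card C = k"

end

theory Submission
  imports Defs
begin

text \<open>Write \<open>X \<preceq> Y\<close> for antichains when every element of \<open>X\<close> lies below an element of
  \<open>Y\<close>, that is, when the down-set of \<open>X\<close> is contained in that of \<open>Y\<close>. Any two antichains \<open>X\<close>,
  \<open>Y\<close> can be \<^emph>\<open>uncrossed\<close>: the multiset \<open>X + Y\<close> is also the sum of two antichains
  \<open>lower X Y \<preceq> upper X Y\<close>. The proof uses edges of the chain polytope only through the following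
  consequence (\<open>edge_exchange\<close>): if \<open>\<rho>(X)\<close> and \<open>\<rho>(Y)\<close> span an edge, then \<open>X + Y\<close> is
  the sum of two antichains in no other way, because the common midpoint of another such pair would lie
  on the edge. Hence the antichains of a clique form a \<^emph>\<open>rigid\<close> family, and
  uncrossing shows that they are a chain \<open>W 0 \<preceq> \<dots> \<preceq> W (k - 1)\<close>.

  Going up this chain, every new \<open>W (Suc i)\<close> contains an element that lies in no earlier member
  (\<open>new_element\<close>); this makes the incidence vectors affinely independent, so that their hull is a
  simplex.

  For the face property, call a chain \<open>K\<close> of the poset \<^emph>\<open>transversal\<close> if it meets all \<open>W i\<close>, and
  let \<open>S\<close> be the union of the \<open>W i\<close>. Since a chain meets an antichain at most once, the functional
  \<open>(\<Sum>K. \<rho>(K)) - \<rho>(P - S)\<close>, with \<open>K\<close> ranging over the transversals, attains its maximum over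
  the antichains \<open>U\<close> exactly where \<open>U \<subseteq> S\<close> and \<open>U\<close> meets every transversal
  (\<open>face_of_chain_polytope\<close>). These \<open>U\<close> are closed under uncrossing, and the combinatorial core is
  that they are precisely the \<open>W i\<close> (\<open>face_antichain_iff\<close>). Uncrossing \<open>U\<close> with the \<open>W i\<close> from
  the top down reduces this to an antichain \<open>A\<close> in a gap, \<open>W i \<preceq> A \<preceq> W (Suc i)\<close>
  (\<open>gap_face_antichain\<close>). If the rest of \<open>W i + W (Suc i)\<close> after removing \<open>A\<close> is an antichain,
  rigidity puts \<open>A\<close> into the clique. Otherwise there are \<open>u \<in> W i\<close> and \<open>v \<in> W (Suc i)\<close> outside
  \<open>A\<close> with \<open>u < v\<close>, and a transversal through both would avoid \<open>A\<close>. Upwards the pair always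
  extends; downwards it does unless \<open>u\<close> is \<^emph>\<open>shallow\<close>, that is, no chain with top \<open>u\<close> meets all of
  \<open>W 0, \<dots>, W i\<close>. But \<open>W i\<close> has at most one shallow element, and if it has one, then \<open>W i\<close> arises
  from an earlier \<open>W l\<close> by adding this element (\<open>shallow_unique\<close>), so the same argument with \<open>W l\<close>
  in place of \<open>W i\<close> succeeds.\<close>

section \<open>Uncrossing antichains\<close>

locale poset_carrier =
  fixes P :: "'a set" and r :: "'a rel"
  assumes partial_order: "partial_order_on P r"
begin

abbreviation antichain :: "'a set \<Rightarrow> bool" where
  "antichain \<equiv> antichain_of P r"

definition below :: "'a set \<Rightarrow> 'a set \<Rightarrow> bool" (infix "\<preceq>" 50) where
  "X \<preceq> Y \<longleftrightarrow> (\<forall>x\<in>X. \<exists>y\<in>Y. (x, y) \<in> r)"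

text \<open>Together, \<open>upper X Y\<close> and \<open>lower X Y\<close> redistribute the elements of \<open>X\<close> and \<open>Y\<close> with their
  multiplicities. The lower part is not simply the set of minimal elements of \<open>X \<union> Y\<close>: an element of
  only one of \<open>X\<close>, \<open>Y\<close> that is both minimal and maximal counts once, and it goes to the upper part.\<close>

definition upper :: "'a set \<Rightarrow> 'a set \<Rightarrow> 'a set" where
  "upper X Y = {z \<in> X \<union> Y. \<forall>y \<in> X \<union> Y. (z, y) \<in> r \<longrightarrow> y = z}"

definition lower :: "'a set \<Rightarrow> 'a set \<Rightarrow> 'a set" where
  "lower X Y = (X \<inter> Y) \<union> (X \<union> Y - upper X Y)"

text \<open>The conditions on \<open>A \<union> B\<close> and \<open>A \<inter> B\<close> say that \<open>A + B = X + Y\<close> as multisets.\<close>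

definition rigid :: "'a set set \<Rightarrow> bool" where
  "rigid \<C> \<longleftrightarrow> (\<forall>X\<in>\<C>. \<forall>Y\<in>\<C>. \<forall>A B. antichain A \<longrightarrow> antichain B \<longrightarrow>
     A \<union> B = X \<union> Y \<longrightarrow> A \<inter> B = X \<inter> Y \<longrightarrow> A = X \<or> A = Y)"

definition chain :: "'a set \<Rightarrow> bool" where
  "chain K \<longleftrightarrow> K \<subseteq> P \<and> (\<forall>x\<in>K. \<forall>y\<in>K. (x, y) \<in> r \<or> (y, x) \<in> r)"

lemma leq_refl: "x \<in> P \<Longrightarrow> (x, x) \<in> r"
  using partial_order by (auto simp: partial_order_on_def preorder_on_def refl_on_def)

lemma leq_trans: "(x, y) \<in> r \<Longrightarrow> (y, z) \<in> r \<Longrightarrow> (x, z) \<in> r"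
  using partial_order by (auto simp: partial_order_on_def preorder_on_def dest: transD)

lemma leq_antisym: "(x, y) \<in> r \<Longrightarrow> (y, x) \<in> r \<Longrightarrow> x = y"
  using partial_order by (auto simp: partial_order_on_def dest: antisymD)

lemma antichain_subset: "antichain X \<Longrightarrow> X \<subseteq> P"
  by (simp add: antichain_of_def)

lemma antichain_eq: "antichain X \<Longrightarrow> x \<in> X \<Longrightarrow> y \<in> X \<Longrightarrow> (x, y) \<in> r \<Longrightarrow> x = y"
  by (auto simp: antichain_of_def)

lemma antichainI:
  "X \<subseteq> P \<Longrightarrow> (\<And>x y. x \<in> X \<Longrightarrow> y \<in> X \<Longrightarrow> (x, y) \<in> r \<Longrightarrow> x = y) \<Longrightarrow> antichain X"
  by (fastforce simp: antichain_of_def)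

lemma antichain_mono: "antichain Y \<Longrightarrow> X \<subseteq> Y \<Longrightarrow> antichain X"
  by (auto simp: antichain_of_def)

lemma below_refl: "X \<subseteq> P \<Longrightarrow> X \<preceq> X"
  using leq_refl by (auto simp: below_def)

lemma below_trans: "X \<preceq> Y \<Longrightarrow> Y \<preceq> Z \<Longrightarrow> X \<preceq> Z"
  unfolding below_def by (meson leq_trans)

text \<open>The element \<open>y\<close> is caught between \<open>x\<close> and some element of \<open>X\<close>, which can only be \<open>x\<close> itself.\<close>

lemma below_sandwich:
  assumes "antichain X" "y \<in> Y" "x \<in> X" "Y \<preceq> X" "(x, y) \<in> r"
  shows "x = y"
proof -
  obtain x' where "x' \<in> X" "(y, x') \<in> r" using assms(2,4) by (auto simp: below_def)
  then show ?thesis using assms leq_trans leq_antisym antichain_eq by metis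
qed

lemma below_antisym:
  assumes "antichain X" "antichain Y" "X \<preceq> Y" "Y \<preceq> X"
  shows "X = Y"
proof -
  have "\<forall>x\<in>X. x \<in> Y"
    using below_sandwich[OF assms(1) _ _ assms(4)] assms(3) unfolding below_def by metis
  moreover have "\<forall>y\<in>Y. y \<in> X"
    using below_sandwich[OF assms(2) _ _ assms(3)] assms(4) unfolding below_def by metis
  ultimately show ?thesis by blast
qed

lemma subset_below_eq:
  assumes "antichain Y" "antichain X" "X \<subseteq> Y" "Y \<preceq> X"
  shows "X = Y"
  using assms below_antisym below_def leq_refl antichain_subset by (metis subset_iff)

lemma upper_antichain: "X \<subseteq> P \<Longrightarrow> Y \<subseteq> P \<Longrightarrow> antichain (upper X Y)"
  by (rule antichainI) (auto simp: upper_def)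

lemma lower_antichain:
  assumes "antichain X" "antichain Y"
  shows "antichain (lower X Y)"
proof (rule antichainI)
  show "lower X Y \<subseteq> P" using assms antichain_subset by (auto simp: lower_def)
  fix x y assume xy: "x \<in> lower X Y" "y \<in> lower X Y" "(x, y) \<in> r"
  show "x = y"
  proof (rule ccontr)
    assume ne: "x \<noteq> y"
    have "y \<notin> X \<inter> Y" using xy ne assms antichain_eq by (auto simp: lower_def)
    then obtain z where z: "z \<in> X \<union> Y" "(y, z) \<in> r" "z \<noteq> y" "y \<in> X \<union> Y"
      using xy by (auto simp: lower_def upper_def)
    have "x \<in> X \<union> Y" using xy by (auto simp: lower_def)
    \<comment> \<open>If \<open>x < y < z\<close> were distinct, two of them would lie in the same antichain.\<close>
    then have "x = z" using z xy ne assms antichain_eq[OF assms(1)] antichain_eq[OF assms(2)] leq_trans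
      by (metis UnE)
    then show False using z xy leq_antisym by metis
  qed
qed

lemma upper_lower_Un: "upper X Y \<union> lower X Y = X \<union> Y"
  by (auto simp: upper_def lower_def)

lemma upper_lower_Int:
  assumes "antichain X" "antichain Y"
  shows "upper X Y \<inter> lower X Y = X \<inter> Y"
  using antichain_eq[OF assms(1)] antichain_eq[OF assms(2)]
  by (auto simp: upper_def lower_def)

lemma below_upper:
  assumes "antichain X" "antichain Y"
  shows "X \<preceq> upper X Y" "Y \<preceq> upper X Y"
proof -
  have "\<exists>y\<in>upper X Y. (z, y) \<in> r" if z: "z \<in> X \<union> Y" for z
  proof (cases "z \<in> upper X Y")
    case True
    then show ?thesis using leq_refl assms antichain_subset z by blast
  next
    case False
    then obtain y where y: "y \<in> X \<union> Y" "(z, y) \<in> r" "y \<noteq> z" using z by (auto simp: upper_def)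
    have "y \<in> upper X Y"
      unfolding upper_def using y z antichain_eq[OF assms(1)] antichain_eq[OF assms(2)]
        leq_trans leq_antisym by (smt (verit) Un_iff mem_Collect_eq)
    then show ?thesis using y by blast
  qed
  then show "X \<preceq> upper X Y" "Y \<preceq> upper X Y" by (auto simp: below_def)
qed

lemma upper_below: "X \<preceq> Z \<Longrightarrow> Y \<preceq> Z \<Longrightarrow> upper X Y \<preceq> Z"
  by (auto simp: below_def upper_def)

lemma lower_below:
  assumes "antichain X" "Y \<subseteq> P"
  shows "lower X Y \<preceq> Y"
  using assms leq_refl antichain_eq[OF assms(1)]
  by (fastforce simp: below_def lower_def upper_def)

lemma rigidD:
  assumes "rigid \<C>" "X \<in> \<C>" "Y \<in> \<C>" "antichain A" "antichain B"
    and "A \<union> B = X \<union> Y" "A \<inter> B = X \<inter> Y"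
  shows "A = X \<or> A = Y"
  using assms(1)[unfolded rigid_def, rule_format, OF assms(2-7)] .

lemma rigid_comparable:
  assumes "rigid \<C>" "X \<in> \<C>" "Y \<in> \<C>" "antichain X" "antichain Y"
  shows "X \<preceq> Y \<or> Y \<preceq> X"
proof -
  have "upper X Y = X \<or> upper X Y = Y"
    by (rule rigidD[OF assms(1-3) upper_antichain lower_antichain upper_lower_Un upper_lower_Int])
      (simp_all add: assms antichain_subset)
  then show ?thesis using below_upper assms by metis
qed

text \<open>As \<open>X \<preceq> Y\<close>, two comparable elements of the complementary multiset \<open>B = X + Y - A\<close> can only be
  some \<open>u \<in> X\<close> below some \<open>v \<in> Y\<close>. So these pairs are the only obstruction to \<open>B\<close> being an antichain.\<close>

lemma complement_antichain:
  assumes X: "antichain X" and Y: "antichain Y" and "A \<subseteq> X \<union> Y" "X \<inter> Y \<subseteq> A" "X \<preceq> Y"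
    and free: "\<And>u v. u \<in> X - A \<Longrightarrow> v \<in> Y - A \<Longrightarrow> (u, v) \<notin> r"
  obtains B where "antichain B" "A \<union> B = X \<union> Y" "A \<inter> B = X \<inter> Y"
proof
  let ?B = "(X \<union> Y - A) \<union> (X \<inter> Y)"
  show "antichain ?B"
  proof (rule antichainI)
    show "?B \<subseteq> P" using X Y antichain_subset by blast
    fix x y assume xy: "x \<in> ?B" "y \<in> ?B" "(x, y) \<in> r"
    show "x = y"
    proof (rule ccontr)
      assume ne: "x \<noteq> y"
      consider "x \<in> X" "y \<in> X" | "x \<in> Y" "y \<in> Y" | "x \<in> X - Y" "y \<in> Y - X" | "x \<in> Y" "y \<in> X"
        using xy by blast
      then show False
      proof cases
        case 3
        then show ?thesis using free xy by blast
      next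
        case 4
        then obtain y' where "y' \<in> Y" "(y, y') \<in> r" using \<open>X \<preceq> Y\<close> by (auto simp: below_def)
        then show ?thesis using 4 xy ne leq_trans leq_antisym antichain_eq[OF Y] by metis
      qed (use xy(3) ne antichain_eq[OF X] antichain_eq[OF Y] in simp_all)
    qed
  qed
  show "A \<union> ?B = X \<union> Y" "A \<inter> ?B = X \<inter> Y" using assms by auto
qed

lemma rigid_subset: "rigid \<C> \<Longrightarrow> \<D> \<subseteq> \<C> \<Longrightarrow> rigid \<D>"
  unfolding rigid_def by (meson subsetD)

lemma finite_rigid_greatest:
  assumes "finite \<C>" "\<C> \<noteq> {}" "rigid \<C>" "\<And>X. X \<in> \<C> \<Longrightarrow> antichain X"
  shows "\<exists>M\<in>\<C>. \<forall>X\<in>\<C>. X \<preceq> M"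
  using assms
proof (induction rule: finite_ne_induct)
  case (singleton X)
  then show ?case using below_refl antichain_subset by simp
next
  case (insert X F)
  have "rigid F" using insert.prems(1) rigid_subset by (metis subset_insertI)
  then obtain M where M: "M \<in> F" "\<forall>X\<in>F. X \<preceq> M" using insert.IH insert.prems(2) by blast
  have anti: "antichain X" "antichain M" using insert.prems(2) M(1) by auto
  then have "X \<preceq> M \<or> M \<preceq> X"
    using rigid_comparable[OF insert.prems(1), of X M] M(1) by simp
  then show ?case
  proof
    assume "X \<preceq> M"
    then show ?thesis using M by auto
  next
    assume "M \<preceq> X"
    then have "\<forall>Y\<in>F. Y \<preceq> X" using M(2) below_trans by blast
    then show ?thesis using below_refl antichain_subset anti by simp
  qed
qed

lemma finite_rigid_enumeration:
  assumes "finite \<C>" "card \<C> = n" "rigid \<C>" "\<And>X. X \<in> \<C> \<Longrightarrow> antichain X"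
  shows "\<exists>W. \<C> = W ` {..<n} \<and> inj_on W {..<n} \<and> (\<forall>i j. i \<le> j \<longrightarrow> j < n \<longrightarrow> W i \<preceq> W j)"
  using assms
proof (induction n arbitrary: \<C>)
  case 0
  then show ?case by simp
next
  case (Suc n)
  have "\<C> \<noteq> {}" using Suc.prems(2) by auto
  then obtain M where M: "M \<in> \<C>" "\<And>X. X \<in> \<C> \<Longrightarrow> X \<preceq> M"
    using finite_rigid_greatest[OF Suc.prems(1) _ Suc.prems(3,4)] by blast
  have "\<exists>W. \<C> - {M} = W ` {..<n} \<and> inj_on W {..<n} \<and> (\<forall>i j. i \<le> j \<longrightarrow> j < n \<longrightarrow> W i \<preceq> W j)"
  proof (rule Suc.IH)
    show "card (\<C> - {M}) = n" using M(1) Suc.prems(1,2) by simp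
    show "rigid (\<C> - {M})" by (rule rigid_subset[OF Suc.prems(3)]) blast
  qed (use Suc.prems in simp_all)
  then obtain W where W: "\<C> - {M} = W ` {..<n}" "inj_on W {..<n}"
    "\<forall>i j. i \<le> j \<longrightarrow> j < n \<longrightarrow> W i \<preceq> W j" by blast
  let ?W = "W(n := M)"
  have im: "?W ` {..<n} = \<C> - {M}" unfolding W(1) by (rule image_cong) auto
  have img: "?W ` {..<Suc n} = \<C>"
    unfolding lessThan_Suc image_insert im using M(1) by (simp add: insert_absorb)
  have "inj_on ?W {..<n}"
    using W(2) by (simp add: inj_on_def)
  moreover have "?W n \<notin> ?W ` {..<n}" unfolding im by simp
  moreover have "{..<n} - {n} = {..<n}" by auto
  ultimately have "inj_on ?W {..<Suc n}" by (simp only: lessThan_Suc inj_on_insert) simp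
  moreover have "?W i \<preceq> ?W j" if "i \<le> j" "j < Suc n" for i j
  proof (cases "j = n")
    case True
    have "?W i \<in> ?W ` {..<Suc n}" using that by (intro imageI) simp
    then have "?W i \<in> \<C>" unfolding img .
    then show ?thesis using M(2) True by simp
  next
    case False
    then show ?thesis using that W(3) by simp
  qed
  ultimately show ?case using img by blast
qed

end

section \<open>Rigid chains of antichains\<close>

locale rigid_chain = poset_carrier +
  fixes W :: "nat \<Rightarrow> 'a set" and k :: nat
  assumes W_antichain: "i < k \<Longrightarrow> antichain (W i)"
    and W_below: "i \<le> j \<Longrightarrow> j < k \<Longrightarrow> W i \<preceq> W j"
    and W_inj: "inj_on W {..<k}"
    and W_rigid: "rigid (W ` {..<k})"
begin

text \<open>Transversals give the valid inequalities \<open>x(K) \<le> 1\<close> that are tight at all \<open>W i\<close>. The face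
  antichains are those at which they and the inequalities \<open>x(a) \<ge> 0\<close> with \<open>a\<close> outside all \<open>W i\<close>
  are tight.\<close>

definition transversal :: "'a set \<Rightarrow> bool" where
  "transversal K \<longleftrightarrow> chain K \<and> (\<forall>j<k. K \<inter> W j \<noteq> {})"

definition face_antichain :: "'a set \<Rightarrow> bool" where
  "face_antichain U \<longleftrightarrow> antichain U \<and> U \<subseteq> (\<Union>j<k. W j) \<and> (\<forall>K. transversal K \<longrightarrow> K \<inter> U \<noteq> {})"

text \<open>A deep \<open>u \<in> W j\<close> is the top of the lower part, up to level \<open>j\<close>, of some transversal; the other
  elements of \<open>W j\<close> are the shallow ones.\<close>

definition deep :: "nat \<Rightarrow> 'a \<Rightarrow> bool" where
  "deep j u \<longleftrightarrow> (\<exists>K. chain K \<and> u \<in> K \<and> (\<forall>z\<in>K. (z, u) \<in> r) \<and> (\<forall>l\<le>j. K \<inter> W l \<noteq> {}))"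

lemma W_eq_iff: "i < k \<Longrightarrow> j < k \<Longrightarrow> W i = W j \<longleftrightarrow> i = j"
  using W_inj by (auto simp: inj_on_def)

lemma W_in_P: "i < k \<Longrightarrow> x \<in> W i \<Longrightarrow> x \<in> P"
  using W_antichain antichain_subset by blast

lemma W_rigidD:
  "i < k \<Longrightarrow> j < k \<Longrightarrow> antichain A \<Longrightarrow> antichain B \<Longrightarrow> A \<union> B = W i \<union> W j \<Longrightarrow> A \<inter> B = W i \<inter> W j
    \<Longrightarrow> A = W i \<or> A = W j"
  using rigidD[OF W_rigid, of "W i" "W j" A B] by auto

text \<open>Since \<open>W l \<preceq> W j\<close>, such a \<open>u\<close> is incomparable to all of \<open>W l\<close> and can be moved from \<open>W j\<close>
  to \<open>W l\<close> without destroying either antichain. Rigidity forces this move to be an exchange of the two.\<close>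

lemma isolated_step:
  assumes "l < j" "j < k" "u \<in> W j" and none: "\<And>z. z \<in> W l \<Longrightarrow> (z, u) \<notin> r"
  shows "W j = insert u (W l)"
proof -
  have lk: "l < k" using assms by simp
  note anti = W_antichain[OF lk] W_antichain[OF \<open>j < k\<close>]
  have uP: "u \<in> P" using assms W_in_P by blast
  have ul: "u \<notin> W l" using none leq_refl uP by blast
  have above: "(u, z) \<notin> r" if z: "z \<in> W l" for z
  proof
    assume "(u, z) \<in> r"
    moreover obtain w where "w \<in> W j" "(z, w) \<in> r"
      using W_below[of l j] assms(1,2) z by (auto simp: below_def)
    ultimately show False
      using antichain_eq[OF anti(2)] assms(3) leq_trans leq_antisym none[OF z] by metis
  qed
  have "antichain (insert u (W l))"
  proof (rule antichainI)
    show "insert u (W l) \<subseteq> P" using uP antichain_subset anti by blast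
  qed (use none above antichain_eq[OF anti(1)] in blast)
  moreover have "antichain (W j - {u})" using anti(2) antichain_mono by blast
  ultimately have "insert u (W l) = W l \<or> insert u (W l) = W j"
    using W_rigidD[OF lk \<open>j < k\<close>] assms(3) ul by blast
  then show ?thesis using ul by blast
qed

lemma deep_extend:
  assumes "deep j z" "Suc j < k" "u \<in> W (Suc j)" "(z, u) \<in> r"
  shows "deep (Suc j) u"
proof -
  obtain K where K: "chain K" "z \<in> K" "\<forall>x\<in>K. (x, z) \<in> r" "\<forall>l\<le>j. K \<inter> W l \<noteq> {}"
    using assms(1) by (auto simp: deep_def)
  have "u \<in> P" using assms W_in_P by blast
  have le: "\<forall>x\<in>insert u K. (x, u) \<in> r" using K assms leq_trans leq_refl[OF \<open>u \<in> P\<close>] by blast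
  moreover have "chain (insert u K)" using K le \<open>u \<in> P\<close> by (auto simp: chain_def)
  moreover have "\<forall>l\<le>Suc j. insert u K \<inter> W l \<noteq> {}"
    using K assms by (auto simp: le_Suc_eq)
  ultimately show ?thesis unfolding deep_def by blast
qed

lemma deep_stay: "deep j v \<Longrightarrow> Suc j < k \<Longrightarrow> v \<in> W (Suc j) \<Longrightarrow> deep (Suc j) v"
  by (rule deep_extend) (auto intro: leq_refl W_in_P)

text \<open>By induction on the level. All elements of \<open>W j\<close> below a shallow \<open>u \<in> W (Suc j)\<close> are shallow, so
  there is at most one, \<open>z\<close>. Without \<open>z\<close>, the element \<open>u\<close> is isolated over \<open>W j\<close>; with \<open>z\<close>, it is
  isolated over the earlier \<open>W l\<close> with \<open>W j = insert z (W l)\<close>. So \<open>isolated_step\<close> applies.\<close>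

lemma shallow_unique:
  assumes "j < k" "u \<in> W j" "\<not> deep j u"
  shows "(\<exists>l<j. W j = insert u (W l)) \<and> (\<forall>v\<in>W j. v \<noteq> u \<longrightarrow> deep j v)"
  using assms
proof (induction j arbitrary: u)
  case 0
  then have "u \<in> P" using W_in_P by blast
  then have "chain {u} \<and> u \<in> {u} \<and> (\<forall>z\<in>{u}. (z, u) \<in> r) \<and> (\<forall>l\<le>0. {u} \<inter> W l \<noteq> {})"
    using 0(2) leq_refl by (simp add: chain_def)
  then have "deep 0 u" unfolding deep_def by blast
  then show ?case using 0(3) by simp
next
  case (Suc j)
  have jk: "j < k" using Suc by simp
  have shallow: "\<not> deep j z" if "(z, u) \<in> r" for z
    using deep_extend[OF _ Suc.prems(1,2) that] Suc.prems(3) by blast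
  show ?case
  proof (cases "\<exists>z\<in>W j. (z, u) \<in> r")
    case False
    then have eq: "W (Suc j) = insert u (W j)" using isolated_step[of j "Suc j" u] Suc.prems by auto
    \<comment> \<open>A shallow \<open>v\<close> in \<open>W j = insert v (W l)\<close> would make \<open>u\<close> isolated over \<open>W l\<close> as well;
      but \<open>W (Suc j)\<close> exceeds \<open>W l\<close> by both \<open>u\<close> and \<open>v\<close>.\<close>
    have all_deep: "deep j v" if v: "v \<in> W j" for v
    proof (rule ccontr)
      assume "\<not> deep j v"
      then obtain l where l: "l < j" "W j = insert v (W l)" using Suc.IH[OF jk v] by blast
      have "W (Suc j) = insert u (W l)"
      proof (rule isolated_step)
        show "(x, u) \<notin> r" if "x \<in> W l" for x using that l(2) False by auto
      qed (use l Suc.prems in simp_all)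
      moreover have "v \<in> W (Suc j)" using eq v by simp
      ultimately have "W j = W (Suc j) \<or> W j = W l" using l(2) by auto
      then show False using jk W_eq_iff[of j "Suc j"] W_eq_iff[of j l] l(1) Suc.prems(1) by auto
    qed
    have "deep (Suc j) v" if "v \<in> W (Suc j)" "v \<noteq> u" for v
      using that eq all_deep[of v] deep_stay[OF _ Suc.prems(1)] by simp
    then show ?thesis using eq by blast
  next
    case True
    then obtain z where z: "z \<in> W j" "(z, u) \<in> r" by blast
    obtain l where l: "l < j" "W j = insert z (W l)" and other: "\<forall>v\<in>W j. v \<noteq> z \<longrightarrow> deep j v"
      using Suc.IH[OF jk z(1) shallow[OF z(2)]] by blast
    have "z \<notin> W l" using l W_eq_iff[of j l] jk by (auto simp: insert_absorb)
    then have deep_l: "deep j v" if "v \<in> W l" for v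
      using that l(2) other by auto
    have eq: "W (Suc j) = insert u (W l)"
    proof (rule isolated_step)
      show "(x, u) \<notin> r" if "x \<in> W l" for x
        using deep_l[OF that] shallow by blast
    qed (use l Suc.prems in simp_all)
    moreover have "deep (Suc j) v" if "v \<in> W (Suc j)" "v \<noteq> u" for v
      using that eq deep_l[of v] deep_stay[OF _ Suc.prems(1)] by simp
    moreover have "l < Suc j" using l(1) by simp
    ultimately show ?thesis by blast
  qed
qed

text \<open>In contrast to the downward direction nothing can fail: \<open>W i \<preceq> W (Suc i)\<close> always offers a next element.\<close>

lemma upward_chain:
  assumes "i < k" "v \<in> W i"
  shows "\<exists>K. chain K \<and> v \<in> K \<and> (\<forall>z\<in>K. (v, z) \<in> r) \<and> (\<forall>l. i \<le> l \<longrightarrow> l < k \<longrightarrow> K \<inter> W l \<noteq> {})"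
  using assms
proof (induction "k - i" arbitrary: i v)
  case 0
  then show ?case by simp
next
  case (Suc n)
  have vP: "v \<in> P" using Suc W_in_P by blast
  show ?case
  proof (cases "Suc i < k")
    case False
    have "{v} \<inter> W l \<noteq> {}" if "i \<le> l" "l < k" for l
    proof -
      have "l = i" using that False by simp
      then show ?thesis using Suc.prems(2) by simp
    qed
    moreover have "chain {v}" "(v, v) \<in> r" using vP leq_refl by (simp_all add: chain_def)
    ultimately show ?thesis by (intro exI[of _ "{v}"]) simp
  next
    case True
    obtain w where w: "w \<in> W (Suc i)" "(v, w) \<in> r"
      using W_below[of i "Suc i"] True Suc.prems by (auto simp: below_def)
    have n: "n = k - Suc i" using Suc.hyps(2) by simp
    obtain K where K: "chain K" "w \<in> K" "\<forall>z\<in>K. (w, z) \<in> r"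
        "\<forall>l. Suc i \<le> l \<longrightarrow> l < k \<longrightarrow> K \<inter> W l \<noteq> {}"
      using Suc.hyps(1)[OF n True w(1)] by blast
    have le: "\<forall>z\<in>insert v K. (v, z) \<in> r" using K w vP leq_refl leq_trans by blast
    then have "chain (insert v K)" using K vP by (auto simp: chain_def)
    moreover have "insert v K \<inter> W l \<noteq> {}" if "i \<le> l" "l < k" for l
      using that K(4) Suc.prems by (cases "l = i") auto
    ultimately show ?thesis using le by blast
  qed
qed

lemma transversal_through:
  assumes "deep i u" "Suc i < k" "v \<in> W (Suc i)" "(u, v) \<in> r"
  shows "\<exists>K. transversal K \<and> (\<forall>z\<in>K. (z, u) \<in> r \<or> (v, z) \<in> r)"
proof -
  obtain K1 where K1: "chain K1" "u \<in> K1" "\<forall>z\<in>K1. (z, u) \<in> r" "\<forall>l\<le>i. K1 \<inter> W l \<noteq> {}"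
    using assms(1) unfolding deep_def by blast
  obtain K2 where K2: "chain K2" "\<forall>z\<in>K2. (v, z) \<in> r"
      "\<forall>l. Suc i \<le> l \<longrightarrow> l < k \<longrightarrow> K2 \<inter> W l \<noteq> {}"
    using upward_chain[OF assms(2,3)] by blast
  have le: "(x, y) \<in> r" if "x \<in> K1" "y \<in> K2" for x y
  proof -
    have "(x, u) \<in> r" "(v, y) \<in> r" using that K1(3) K2(2) by simp_all
    then show ?thesis using assms(4) leq_trans by meson
  qed
  have "chain (K1 \<union> K2)"
    using K1(1) K2(1) le by (auto simp: chain_def)
  moreover have "(K1 \<union> K2) \<inter> W j \<noteq> {}" if "j < k" for j
  proof (cases "j \<le> i")
    case True
    then show ?thesis using K1(4) by blast
  next
    case False
    then show ?thesis using K2(3) that not_less_eq_eq by blast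
  qed
  ultimately have "transversal (K1 \<union> K2)" by (simp add: transversal_def)
  then show ?thesis using K1(3) K2(2) by blast
qed

text \<open>The gap below \<open>W 0\<close>. Every element of \<open>A\<close> lies in some \<open>W j\<close> and below \<open>W 0 \<preceq> W j\<close>, hence in
  \<open>W 0\<close>; conversely, an upward chain from \<open>v \<in> W 0\<close> is a transversal and can meet \<open>A \<subseteq> W 0\<close> only in \<open>v\<close>.\<close>

lemma bottom_face_antichain:
  assumes "face_antichain A" "0 < k" "A \<preceq> W 0"
  shows "A = W 0"
proof -
  have A: "antichain A" "A \<subseteq> (\<Union>j<k. W j)" using assms by (auto simp: face_antichain_def)
  have sub: "A \<subseteq> W 0"
  proof
    fix a assume a: "a \<in> A"
    then obtain j where j: "j < k" "a \<in> W j" using A by blast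
    obtain w where w: "w \<in> W 0" "(a, w) \<in> r" using a assms(3) by (auto simp: below_def)
    obtain w' where w': "w' \<in> W j" "(w, w') \<in> r"
      using w W_below[of 0 j] j by (auto simp: below_def)
    have "a = w'" using antichain_eq[OF W_antichain[OF j(1)] j(2) w'(1)] w w' leq_trans by blast
    then show "a \<in> W 0" using w w' leq_antisym by metis
  qed
  moreover have "W 0 \<subseteq> A"
  proof
    fix v assume v: "v \<in> W 0"
    obtain K where "chain K" "\<forall>z\<in>K. (v, z) \<in> r" "\<forall>l<k. K \<inter> W l \<noteq> {}"
      using upward_chain[OF assms(2) v] by auto
    moreover from this have "transversal K" by (simp add: transversal_def)
    ultimately obtain z where "z \<in> A" "(v, z) \<in> r"
      using assms(1) unfolding face_antichain_def by blast
    then show "v \<in> A" using antichain_eq[OF W_antichain[OF assms(2)] v] sub by blast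
  qed
  ultimately show ?thesis by blast
qed

text \<open>The argument runs with a level \<open>l \<le> i\<close> such that \<open>A \<subseteq> W l \<union> W (Suc i)\<close>: it is \<open>l = i\<close> unless a
  shallow element of \<open>W i\<close> obstructs, and then the level that \<open>shallow_unique\<close> provides.\<close>

lemma gap_face_antichain:
  assumes "face_antichain A" "Suc i < k" "W i \<preceq> A" "A \<preceq> W (Suc i)"
  shows "A \<in> W ` {..<k}"
proof -
  have A: "antichain A" "A \<subseteq> (\<Union>j<k. W j)" using assms by (auto simp: face_antichain_def)
  have ik: "i < k" using assms by simp
  note anti = W_antichain[OF ik] W_antichain[OF assms(2)]
  have sub: "A \<subseteq> W i \<union> W (Suc i)"
  proof
    fix a assume a: "a \<in> A"
    then obtain j where j: "j < k" "a \<in> W j" using A by blast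
    show "a \<in> W i \<union> W (Suc i)"
    proof (cases "j \<le> i")
      case True
      then obtain w where w: "w \<in> W i" "(a, w) \<in> r"
        using j W_below[of j i] ik by (auto simp: below_def)
      obtain a' where a': "a' \<in> A" "(w, a') \<in> r" using w assms(3) by (auto simp: below_def)
      have "a = a'" using antichain_eq[OF A(1) a a'(1)] w a' leq_trans by blast
      then show ?thesis using w a' leq_antisym by (metis Un_iff)
    next
      case False
      obtain w where w: "w \<in> W (Suc i)" "(a, w) \<in> r" using a assms(4) by (auto simp: below_def)
      obtain w' where w': "w' \<in> W j" "(w, w') \<in> r"
        using w W_below[of "Suc i" j] j False by (auto simp: below_def)
      have "a = w'" using antichain_eq[OF W_antichain[OF j(1)] j(2) w'(1)] w w' leq_trans by blast
      then show ?thesis using w w' leq_antisym by (metis Un_iff)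
    qed
  qed
  have common: "W l \<inter> W (Suc i) \<subseteq> A" if "l \<le> i" for l
  proof
    fix x assume x: "x \<in> W l \<inter> W (Suc i)"
    have "W l \<preceq> A" using W_below[of l i] that ik assms(3) below_trans by blast
    then obtain a where a: "a \<in> A" "(x, a) \<in> r" using x by (auto simp: below_def)
    obtain w where w: "w \<in> W (Suc i)" "(a, w) \<in> r" using a assms(4) by (auto simp: below_def)
    have "x = w" using antichain_eq[OF anti(2)] x w a leq_trans by blast
    then show "x \<in> A" using a w leq_antisym by metis
  qed
  \<comment> \<open>A transversal through \<open>u\<close> and \<open>v\<close> has to meet \<open>A\<close>, below \<open>u\<close> or above \<open>v\<close>. As
    \<open>W i \<preceq> A \<preceq> W (Suc i)\<close>, the meeting point would be \<open>u\<close> or \<open>v\<close> itself.\<close>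
  have no_deep: "\<not> deep i u" if u: "u \<in> W i - A" and v: "v \<in> W (Suc i) - A" and uv: "(u, v) \<in> r" for u v
  proof
    assume "deep i u"
    moreover have "v \<in> W (Suc i)" using v by simp
    ultimately obtain K where K: "transversal K" "\<forall>z\<in>K. (z, u) \<in> r \<or> (v, z) \<in> r"
      using transversal_through[OF _ assms(2) _ uv] by metis
    then have "K \<inter> A \<noteq> {}" using assms(1) by (simp add: face_antichain_def)
    then obtain z where z: "z \<in> A" "(z, u) \<in> r \<or> (v, z) \<in> r" using K(2) by blast
    from z(2) show False
    proof
      assume zu: "(z, u) \<in> r"
      obtain a where a: "a \<in> A" "(u, a) \<in> r" using u assms(3) by (auto simp: below_def)
      have "z = a" using antichain_eq[OF A(1) z(1) a(1) leq_trans[OF zu a(2)]] .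
      then have "u = a" using zu a(2) leq_antisym by metis
      then show False using u a(1) by simp
    next
      assume vz: "(v, z) \<in> r"
      obtain w where w: "w \<in> W (Suc i)" "(z, w) \<in> r" using z assms(4) by (auto simp: below_def)
      have "v = w" using antichain_eq[OF anti(2) _ w(1) leq_trans[OF vz w(2)]] v by simp
      then have "v = z" using vz w(2) leq_antisym by metis
      then show False using v z(1) by simp
    qed
  qed
  have member: "A \<in> W ` {..<k}"
    if l: "l \<le> i" "A \<subseteq> W l \<union> W (Suc i)"
      and free: "\<And>u v. u \<in> W l - A \<Longrightarrow> v \<in> W (Suc i) - A \<Longrightarrow> (u, v) \<notin> r" for l
  proof -
    have lk: "l < k" using l ik by simp
    have below: "W l \<preceq> W (Suc i)" using W_below l(1) assms(2) by simp
    obtain B where "antichain B" "A \<union> B = W l \<union> W (Suc i)" "A \<inter> B = W l \<inter> W (Suc i)"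
      by (rule complement_antichain[OF W_antichain[OF lk] anti(2) l(2) common[OF l(1)] below free])
    then have "A = W l \<or> A = W (Suc i)" using W_rigidD[OF lk assms(2) A(1)] by blast
    then show ?thesis using lk assms(2) by blast
  qed
  show ?thesis
  proof (cases "\<exists>u v. u \<in> W i - A \<and> v \<in> W (Suc i) - A \<and> (u, v) \<in> r")
    case False
    then show ?thesis using member[OF order_refl sub] by metis
  next
    case True
    then obtain u where u: "u \<in> W i - A" "\<not> deep i u" using no_deep by metis
    moreover from u(1) have "u \<in> W i" by simp
    ultimately obtain l where l: "l < i" "W i = insert u (W l)"
        and other: "\<forall>v\<in>W i. v \<noteq> u \<longrightarrow> deep i v"
      using shallow_unique[OF ik] by metis
    have "u \<notin> W l" using l W_eq_iff[of i l] ik by (auto simp: insert_absorb)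
    show ?thesis
    proof (rule member)
      show "l \<le> i" using l by simp
      show "A \<subseteq> W l \<union> W (Suc i)" using sub u(1) l(2) by auto
      show "(x, y) \<notin> r" if "x \<in> W l - A" "y \<in> W (Suc i) - A" for x y
      proof
        assume xy: "(x, y) \<in> r"
        have x: "x \<in> W i - A" "x \<noteq> u" using that(1) l(2) \<open>u \<notin> W l\<close> by auto
        then have "deep i x" using other by simp
        then show False using no_deep[OF x(1) that(2) xy] by simp
      qed
    qed
  qed
qed

lemma transversal_card:
  assumes "transversal K" "antichain U"
  shows "card (K \<inter> U) \<le> 1"
proof -
  have "x = y" if "x \<in> K \<inter> U" "y \<in> K \<inter> U" for x y
    using that assms antichain_eq[OF assms(2)] unfolding transversal_def chain_def by blast
  then have "K \<inter> U = {} \<or> (\<exists>x. K \<inter> U = {x})" by blast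
  then show ?thesis by auto
qed

text \<open>A transversal meets \<open>U + V\<close> in exactly two elements with multiplicity, and each of the two new
  antichains takes at most one of them.\<close>

lemma uncross_face_antichain:
  assumes "face_antichain U" "face_antichain V"
  shows "face_antichain (upper U V)" "face_antichain (lower U V)"
proof -
  have anti: "antichain U" "antichain V" using assms by (auto simp: face_antichain_def)
  have UV: "antichain (upper U V)" "antichain (lower U V)"
    using anti upper_antichain lower_antichain antichain_subset by auto
  have meets: "K \<inter> upper U V \<noteq> {} \<and> K \<inter> lower U V \<noteq> {}" if K: "transversal K" for K
  proof -
    obtain x y where x: "x \<in> K \<inter> U" and y: "y \<in> K \<inter> V"
      using assms K unfolding face_antichain_def by blast
    have xy: "x \<in> upper U V \<union> lower U V" "y \<in> upper U V \<union> lower U V"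
      unfolding upper_lower_Un using x y by auto
    show ?thesis
    proof (cases "x = y")
      case True
      then have "x \<in> upper U V \<inter> lower U V" unfolding upper_lower_Int[OF anti] using x y by blast
      then show ?thesis using x by blast
    next
      case False
      have "\<not> (x \<in> upper U V \<and> y \<in> upper U V)" "\<not> (x \<in> lower U V \<and> y \<in> lower U V)"
        using False x y K UV antichain_eq unfolding transversal_def chain_def by blast+
      then show ?thesis using xy x y by blast
    qed
  qed
  have "upper U V \<subseteq> U \<union> V" "lower U V \<subseteq> U \<union> V" using upper_lower_Un by blast+
  then show "face_antichain (upper U V)" "face_antichain (lower U V)"
    using assms UV meets unfolding face_antichain_def by blast+
qed

lemma W_face_antichain: "i < k \<Longrightarrow> face_antichain (W i)"
  using W_antichain by (auto simp: face_antichain_def transversal_def)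

text \<open>Uncrossing \<open>U \<preceq> W (Suc i)\<close> with \<open>W i\<close> yields an antichain in the gap below \<open>W (Suc i)\<close> and one
  below \<open>W i\<close>. Both are members of the chain, the latter by induction, and rigidity applied to this
  pair of members shows that \<open>U\<close> is one of them.\<close>

lemma face_antichain_below:
  "i < k \<Longrightarrow> face_antichain U \<Longrightarrow> U \<preceq> W i \<Longrightarrow> U \<in> W ` {..<k}"
proof (induction i arbitrary: U)
  case 0
  then show ?case using bottom_face_antichain by blast
next
  case (Suc i)
  have ik: "i < k" using Suc by simp
  have U: "antichain U" using Suc by (simp add: face_antichain_def)
  note Wi = W_antichain[OF ik]
  let ?A = "upper U (W i)" and ?B = "lower U (W i)"
  have AB: "face_antichain ?A" "face_antichain ?B"
    using uncross_face_antichain Suc.prems W_face_antichain ik by auto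
  have "?A \<preceq> W (Suc i)" using upper_below Suc.prems W_below[of i "Suc i"] by simp
  then have A: "?A \<in> W ` {..<k}" using gap_face_antichain[OF AB(1) Suc.prems(1)] below_upper[OF U Wi] by blast
  have B: "?B \<in> W ` {..<k}"
    using Suc.IH[OF ik AB(2)] lower_below[OF U] antichain_subset[OF Wi] by blast
  have "U = ?A \<or> U = ?B"
    using rigidD[OF W_rigid A B U Wi] upper_lower_Un[of U "W i"] upper_lower_Int[OF U Wi] by auto
  then show ?case using A B by metis
qed

lemma face_antichain_iff: "0 < k \<Longrightarrow> face_antichain U \<longleftrightarrow> U \<in> W ` {..<k}"
proof
  assume k: "0 < k" and U: "face_antichain U"
  have "U \<preceq> W (k - 1)"
    unfolding below_def
  proof
    fix x assume "x \<in> U"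
    then obtain j where "j < k" "x \<in> W j" using U by (auto simp: face_antichain_def)
    then show "\<exists>y\<in>W (k - 1). (x, y) \<in> r" using W_below[of j "k - 1"] k by (auto simp: below_def)
  qed
  then show "U \<in> W ` {..<k}" using face_antichain_below[of "k - 1"] U k by simp
qed (use W_face_antichain in auto)

text \<open>An element of \<open>W (Suc i)\<close> that also lies in an earlier \<open>W j\<close> is caught between \<open>W j \<preceq> W i \<preceq> W (Suc i)\<close>
  and so lies in \<open>W i\<close>; and \<open>W (Suc i) \<subseteq> W i\<close> would make the two equal.\<close>

lemma new_element:
  assumes "Suc i < k"
  obtains a where "a \<in> W (Suc i)" "\<And>j. j \<le> i \<Longrightarrow> a \<notin> W j"
proof -
  have "\<not> W (Suc i) \<subseteq> W i"
  proof
    assume "W (Suc i) \<subseteq> W i"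
    then have "W (Suc i) = W i"
      using subset_below_eq[of "W i" "W (Suc i)"] W_antichain W_below[of i "Suc i"] assms by auto
    then show False using W_eq_iff[of "Suc i" i] assms by auto
  qed
  then obtain a where a: "a \<in> W (Suc i)" "a \<notin> W i" by blast
  have "a \<notin> W j" if ji: "j \<le> i" for j
  proof
    assume "a \<in> W j"
    then obtain w where w: "w \<in> W i" "(a, w) \<in> r"
      using W_below[of j i] ji assms by (auto simp: below_def)
    obtain w' where w': "w' \<in> W (Suc i)" "(w, w') \<in> r"
      using w W_below[of i "Suc i"] assms by (auto simp: below_def)
    have "a = w'" using antichain_eq[OF W_antichain[OF assms] a(1) w'(1)] w w' leq_trans by blast
    then show False using w w' a leq_antisym by metis
  qed
  then show ?thesis using a that by blast
qed

end

section \<open>Incidence vectors\<close>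

lemma rho_nth: "rho p U $ i = (if p i \<in> U then 1 else 0)"
proof -
  have "rho p U $ i = (\<Sum>j | p j \<in> U. if j = i then 1 else 0)"
    unfolding rho_def by (simp add: axis_def)
  then show ?thesis by simp
qed

lemma rho_inner:
  fixes p :: "'n::finite \<Rightarrow> 'a"
  assumes "bij_betw p UNIV P" "U \<subseteq> P"
  shows "rho p K \<bullet> rho p U = card (K \<inter> U)"
proof -
  have "rho p K \<bullet> rho p U = (\<Sum>i\<in>UNIV. if p i \<in> K \<inter> U then 1 else 0)"
    unfolding inner_vec_def by (rule sum.cong) (auto simp: rho_nth)
  also have "\<dots> = card {i. p i \<in> K \<inter> U}" by (simp add: sum.If_cases)
  also have "card {i. p i \<in> K \<inter> U} = card (p ` {i. p i \<in> K \<inter> U})"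
    using assms(1) by (intro card_image[symmetric]) (auto simp: bij_betw_def inj_on_def)
  also have "p ` {i. p i \<in> K \<inter> U} = K \<inter> U"
    using assms by (auto simp: bij_betw_def)
  finally show ?thesis by simp
qed

lemma rho_eq_iff:
  assumes "bij_betw p UNIV P" "U \<subseteq> P" "V \<subseteq> P"
  shows "rho p U = rho p V \<longleftrightarrow> U = V"
proof
  assume eq: "rho p U = rho p V"
  have "p i \<in> U \<longleftrightarrow> p i \<in> V" for i
    using arg_cong[OF eq, of "\<lambda>x. x $ i"] by (simp add: rho_nth split: if_splits)
  moreover have "P = range p" using assms by (simp add: bij_betw_def)
  ultimately show "U = V" using assms by blast
qed simp

lemma rho_add:
  assumes "A \<union> B = X \<union> Y" "A \<inter> B = X \<inter> Y"
  shows "rho p A + rho p B = rho p X + rho p Y"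
proof -
  have "p i \<in> A \<union> B \<longleftrightarrow> p i \<in> X \<union> Y" "p i \<in> A \<inter> B \<longleftrightarrow> p i \<in> X \<inter> Y" for i
    using assms by simp_all
  then show ?thesis by (auto simp: vec_eq_iff rho_nth)
qed

text \<open>A coordinate in which \<open>X\<close> and \<open>Y\<close> differ takes all values between 0 and 1 along the segment, but
  only the values 0 and 1 at incidence vectors.\<close>

lemma rho_in_segment:
  assumes "bij_betw p UNIV P" "X \<subseteq> P" "Y \<subseteq> P" "rho p A \<in> closed_segment (rho p X) (rho p Y)"
  shows "rho p A = rho p X \<or> rho p A = rho p Y"
proof (cases "X = Y")
  case False
  obtain t where t: "rho p A = (1 - t) *\<^sub>R rho p X + t *\<^sub>R rho p Y"
    using assms(4) by (auto simp: closed_segment_def)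
  have "P = range p" using assms by (simp add: bij_betw_def)
  then obtain i where i: "(p i \<in> X) \<noteq> (p i \<in> Y)" using False assms by blast
  have "rho p A $ i = (1 - t) * rho p X $ i + t * rho p Y $ i" using t by simp
  then have "t = 0 \<or> t = 1" using i by (auto simp: rho_nth split: if_splits)
  then show ?thesis using t by auto
qed (use assms in simp)

lemma face_of_convex_hull_by_functional:
  fixes S :: "'v::euclidean_space set"
  assumes "finite S" "T \<subseteq> S" "\<And>x. x \<in> T \<Longrightarrow> c \<bullet> x = m" "\<And>x. x \<in> S - T \<Longrightarrow> c \<bullet> x < m"
  shows "convex hull T face_of convex hull S"
proof (rule face_of_convex_hulls[OF assms(1,2)])
  have "affine hull T \<subseteq> {x. c \<bullet> x = m}"
    using assms(3) by (intro hull_minimal) (auto simp: affine_hyperplane)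
  moreover have "convex hull (S - T) \<subseteq> {x. c \<bullet> x < m}"
    using assms(4) by (intro hull_minimal) (auto simp: convex_halfspace_lt)
  ultimately show "affine hull T \<inter> convex hull (S - T) = {}" by fastforce
qed

context rigid_chain
begin

lemma face_of_chain_polytope:
  fixes p :: "'n::finite \<Rightarrow> 'a"
  assumes p: "bij_betw p UNIV P" and k: "0 < k"
  shows "convex hull (rho p ` W ` {..<k}) face_of chain_polytope P r p"
proof -
  have finP: "finite P" using bij_betw_finite[OF p] finite by metis
  define \<K> where "\<K> = {K. transversal K}"
  define S where "S = (\<Union>j<k. W j)"
  define c where "c = (\<Sum>K\<in>\<K>. rho p K) - rho p (P - S)"
  have "\<K> \<subseteq> Pow P" by (auto simp: \<K>_def transversal_def chain_def)
  then have fin\<K>: "finite \<K>" using finP finite_subset by blast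
  have c: "c \<bullet> rho p U = (\<Sum>K\<in>\<K>. real (card (K \<inter> U))) - card (U - S)" if "antichain U" for U
  proof -
    have "U \<subseteq> P" using that antichain_subset by blast
    moreover from this have "(P - S) \<inter> U = U - S" by blast
    ultimately show ?thesis
      unfolding c_def using rho_inner[OF p] by (simp add: inner_diff_left inner_sum_left)
  qed
  have count: "card (K \<inter> U) \<le> 1" if "K \<in> \<K>" "antichain U" for K U
    using that transversal_card by (simp add: \<K>_def)
  \<comment> \<open>By the formula for \<open>c\<close>, each transversal contributes at most 1 and each element outside \<open>S\<close>
    contributes -1; equality characterises the face antichains.\<close>
  have attained: "c \<bullet> rho p U = card \<K>" if "face_antichain U" for U
  proof -
    have U: "antichain U" "U - S = {}" using that by (auto simp: face_antichain_def S_def)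
    have "card (K \<inter> U) = 1" if "K \<in> \<K>" for K
    proof -
      have "K \<inter> U \<noteq> {}" using \<open>face_antichain U\<close> that by (auto simp: face_antichain_def \<K>_def)
      moreover have "finite (K \<inter> U)" using U(1) antichain_subset finP by (meson finite_Int finite_subset)
      ultimately have "card (K \<inter> U) \<noteq> 0" by simp
      then show ?thesis using count[OF that U(1)] by simp
    qed
    then show ?thesis unfolding c[OF U(1)] U(2) by simp
  qed
  have strict: "c \<bullet> rho p U < card \<K>" if U: "antichain U" "\<not> face_antichain U" for U
  proof -
    have le: "(\<Sum>K\<in>\<K>. real (card (K \<inter> U))) \<le> (\<Sum>K\<in>\<K>. 1)"
      using count U by (intro sum_mono) (simp add: order_le_less)
    show ?thesis
    proof (cases "U \<subseteq> S")
      case False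
      have "finite (U - S)" using U(1) antichain_subset finP by (meson finite_Diff finite_subset)
      then have "card (U - S) > 0" using False card_gt_0_iff by blast
      then show ?thesis using le c[OF U(1)] by simp
    next
      case True
      then obtain K where K: "K \<in> \<K>" "K \<inter> U = {}"
        using U by (auto simp: face_antichain_def S_def \<K>_def)
      then have "\<exists>K\<in>\<K>. real (card (K \<inter> U)) < 1" by (intro bexI[of _ K]) simp_all
      moreover have "\<forall>K\<in>\<K>. real (card (K \<inter> U)) \<le> 1" using count[OF _ U(1)] by fastforce
      ultimately have "(\<Sum>K\<in>\<K>. real (card (K \<inter> U))) < (\<Sum>K\<in>\<K>. 1)"
        using fin\<K> by (intro sum_strict_mono_ex1)
      then show ?thesis using c[OF U(1)] by simp
    qed
  qed
  let ?T = "{rho p U | U. antichain U}"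
  have "?T = rho p ` {U. antichain U}" by blast
  moreover have "{U. antichain U} \<subseteq> Pow P" using antichain_subset by blast
  ultimately have "finite ?T" using finP finite_subset by (metis finite_Pow_iff finite_imageI)
  then show ?thesis
    unfolding chain_polytope_def
  proof (rule face_of_convex_hull_by_functional[where c = c and m = "card \<K>"])
    show "rho p ` W ` {..<k} \<subseteq> ?T" using W_antichain by blast
    show "c \<bullet> x = card \<K>" if "x \<in> rho p ` W ` {..<k}" for x
      using that attained W_face_antichain by auto
    show "c \<bullet> x < card \<K>" if x: "x \<in> ?T - rho p ` W ` {..<k}" for x
    proof -
      obtain U where U: "x = rho p U" "antichain U" using x by blast
      then have "\<not> face_antichain U" using x U(1) face_antichain_iff[OF k] by blast
      then show ?thesis using strict U by simp
    qed
  qed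
qed

text \<open>A new element of the last antichain is a coordinate that vanishes on the affine hull of the previous
  vectors and equals 1 on the last one.\<close>

lemma rho_affine_independent:
  fixes p :: "'n::finite \<Rightarrow> 'a"
  assumes p: "bij_betw p UNIV P" and "n \<le> k"
  shows "\<not> affine_dependent (rho p ` W ` {..<n})"
  using assms(2)
proof (induction n)
  case 0
  then show ?case by simp
next
  case (Suc n)
  show ?case
  proof (cases n)
    case 0
    then show ?thesis by (simp add: lessThan_Suc)
  next
    case (Suc i)
    then obtain a where a: "a \<in> W n" "\<And>j. j < n \<Longrightarrow> a \<notin> W j"
      using new_element[of i] Suc.prems by (metis less_Suc_eq_le Suc_le_lessD)
    have "a \<in> range p" using p W_in_P[OF _ a(1)] Suc.prems by (simp add: bij_betw_def)
    then obtain q where q: "p q = a" by blast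
    have "affine hull (rho p ` W ` {..<n}) \<subseteq> {x. axis q 1 \<bullet> x = 0}"
    proof (rule hull_minimal)
      show "rho p ` W ` {..<n} \<subseteq> {x. axis q 1 \<bullet> x = 0}"
        by (auto simp: inner_axis' rho_nth q a)
    qed (rule affine_hyperplane)
    moreover have "rho p (W n) \<notin> {x. axis q 1 \<bullet> x = 0}"
      by (simp add: inner_axis' rho_nth q a)
    ultimately have "rho p (W n) \<notin> affine hull (rho p ` W ` {..<n})" by blast
    moreover have "\<not> affine_dependent (rho p ` W ` {..<n})" using Suc.IH Suc.prems by simp
    ultimately show ?thesis
      unfolding lessThan_Suc image_insert by (rule affine_independent_insert[rotated])
  qed
qed

end

text \<open>Both pairs of vectors have the same midpoint. A face containing it contains \<open>\<rho>(A)\<close> and \<open>\<rho>(B)\<close>, and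
  the only incidence vectors on the segment are its endpoints.\<close>

lemma edge_exchange:
  fixes p :: "'n::finite \<Rightarrow> 'a"
  assumes p: "bij_betw p UNIV P"
    and face: "convex hull {rho p X, rho p Y} face_of chain_polytope P r p"
    and anti: "antichain_of P r X" "antichain_of P r Y" "antichain_of P r A" "antichain_of P r B"
    and AB: "A \<union> B = X \<union> Y" "A \<inter> B = X \<inter> Y"
  shows "A = X \<or> A = Y"
proof -
  have sub: "X \<subseteq> P" "Y \<subseteq> P" "A \<subseteq> P" using anti by (auto simp: antichain_of_def)
  have mem: "rho p A \<in> chain_polytope P r p" "rho p B \<in> chain_polytope P r p"
    unfolding chain_polytope_def using anti by (auto intro: hull_inc)
  have mid: "midpoint (rho p A) (rho p B) = midpoint (rho p X) (rho p Y)"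
    unfolding midpoint_def using rho_add[OF AB] by metis
  then have midseg: "midpoint (rho p A) (rho p B) \<in> convex hull {rho p X, rho p Y}"
    by (simp add: segment_convex_hull[symmetric])
  have "rho p A \<in> convex hull {rho p X, rho p Y}"
  proof (cases "rho p A = rho p B")
    case True
    then show ?thesis using midseg by simp
  next
    case False
    then have "midpoint (rho p A) (rho p B) \<in> open_segment (rho p A) (rho p B)" by simp
    then show ?thesis using face_ofD[OF face _ mem midseg] by blast
  qed
  then have "rho p A = rho p X \<or> rho p A = rho p Y"
    using rho_in_segment[OF p sub(1,2)] by (simp add: segment_convex_hull)
  then show ?thesis using rho_eq_iff[OF p] sub by blast
qed

theorem theorem3p5:
  fixes P :: "'a set" and r :: "'a rel" and p :: "'n::finite \<Rightarrow> 'a"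
    and C :: "(real ^ 'n) set" and k :: nat
  assumes "partial_order_on P r"
    and "bij_betw p UNIV P"
    and "C \<subseteq> vertices (chain_polytope P r p)"
    and "clique_of (skeleton (chain_polytope P r p)) k C"
  shows "(convex hull C) face_of (chain_polytope P r p)
       \<and> (int k - 1) simplex (convex hull C)"
proof -
  interpret poset_carrier P r by unfold_locales (rule assms(1))
  have finC: "finite C" "card C = k"
    and edges: "\<And>v w. v \<in> C \<Longrightarrow> w \<in> C \<Longrightarrow> v \<noteq> w \<Longrightarrow>
      {v, w} \<in> snd (skeleton (chain_polytope P r p))"
    using assms(4) by (auto simp: clique_of_def)
  have face: "convex hull {v, w} face_of chain_polytope P r p" if "v \<in> C" "w \<in> C" for v w
  proof (cases "v = w")
    case True
    then show ?thesis using assms(3) that by (auto simp: vertices_def face_of_singleton)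
  next
    case False
    then show ?thesis using edges[OF that] by (auto simp: skeleton_def edge_of_def)
  qed
  have inj: "inj_on (rho p) {U. antichain U}"
    by (rule inj_onI) (use rho_eq_iff[OF assms(2)] antichain_subset in blast)
  have "C \<subseteq> rho p ` {U. antichain U}"
  proof
    fix v assume "v \<in> C"
    then have "v extreme_point_of convex hull {rho p U | U. antichain U}"
      using assms(3) by (auto simp: vertices_def chain_polytope_def)
    then show "v \<in> rho p ` {U. antichain U}" using extreme_point_of_convex_hull by blast
  qed
  then obtain \<C> where \<C>: "\<C> \<subseteq> {U. antichain U}" "C = rho p ` \<C>"
    by (metis subset_imageE)
  have inj\<C>: "inj_on (rho p) \<C>" using inj \<C>(1) inj_on_subset by blast
  have fin\<C>: "finite \<C>" "card \<C> = k"
    using finC \<C>(2) inj\<C> finite_image_iff card_image by metis+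
  have rig: "rigid \<C>"
    unfolding rigid_def using edge_exchange[OF assms(2)] face \<C> by blast
  obtain W where W: "\<C> = W ` {..<k}" "inj_on W {..<k}"
      "\<forall>i j. i \<le> j \<longrightarrow> j < k \<longrightarrow> W i \<preceq> W j"
    using finite_rigid_enumeration[OF fin\<C> rig] \<C>(1) by blast
  interpret rigid_chain P r W k
    by unfold_locales (use W \<C> rig in auto)
  have C: "C = rho p ` W ` {..<k}" using \<C> W by simp
  have "convex hull C face_of chain_polytope P r p"
  proof (cases "k = 0")
    case True
    then show ?thesis using C by simp
  next
    case False
    then show ?thesis unfolding C using face_of_chain_polytope[OF assms(2)] by simp
  qed
  moreover have "(int k - 1) simplex (convex hull C)"
    unfolding simplex_def using rho_affine_independent[OF assms(2) order_refl] C finC by auto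
  ultimately show ?thesis by blast
qed

end
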